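(* Let $T$ be a tree. Then $\mathsf{TS}_2(T)$ is acyclic if and only if $T$ is $\{2K_2, D_{2,2,2}\}$-free.
   Context: Graphs are finite, simple and undirected. For a graph $G$ and an integer $k\ge 2$, $\mathsf{TS}_k(G)$ is the graph whose nodes are all size-$k$ independent sets of $G$, two nodes $I,J$ being adjacent if there are vertices $u,v$ of $G$ with $I\setminus J=\{u\}$, $J\setminus I=\{v\}$ and $uv\in E(G)$. (A graph with no nodes counts as acyclic.) $2K_2$ is the disjoint union of two copies of $K_2$. For integers $n,r,s\ge 1$, $D_{r,n,s}$ is the tree obtained from the path $P_n$ on $n$ vertices by attaching $r$ leaves to one end vertex and $s$ leaves to the other end vertex. A graph is $\mathcal{F}$-free if it contains no member of $\mathcal{F}$ as an induced subgraph (up to isomorphism). *)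

theory Defs
  imports "Graph_Theory.Digraph_Isomorphism"
begin

text \<open>
  Finite simple undirected graphs are the \<open>pair_graph\<close>s: finite, loop-free, with a symmetric
  arc set in which an edge \<open>uv\<close> is the pair of arcs \<open>(u, v)\<close> and \<open>(v, u)\<close>.
\<close>

text \<open>
  For symmetric digraphs the predicates \<open>forest\<close> and \<open>tree\<close> of the library are not the undirected
  notions: \<open>cycle\<close> already holds of the closed walk \<open>u, v, u\<close> along a single edge. The cycles of an
  undirected simple graph are those of length at least 3.
\<close>

definition acyclic_graph :: "'a pair_pre_digraph \<Rightarrow> bool" where
  "acyclic_graph G \<longleftrightarrow> \<not> (\<exists>p. pre_digraph.cycle (with_proj G) p \<and> 3 \<le> length p)"

text \<open>\<open>connected\<close> includes that the vertex set is nonempty.\<close>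

definition tree_graph :: "'a pair_pre_digraph \<Rightarrow> bool" where
  "tree_graph G \<longleftrightarrow> pair_graph G \<and> connected (with_proj G) \<and> acyclic_graph G"

definition independent_set :: "'a pair_pre_digraph \<Rightarrow> 'a set \<Rightarrow> bool" where
  "independent_set G I \<longleftrightarrow> I \<subseteq> pverts G \<and> (\<forall>u\<in>I. \<forall>v\<in>I. (u, v) \<notin> parcs G)"

definition TS :: "nat \<Rightarrow> 'a pair_pre_digraph \<Rightarrow> 'a set pair_pre_digraph" where
  "TS k G =
    (let N = {I. independent_set G I \<and> card I = k} in
     \<lparr> pverts = N,
       parcs = {(I, J). I \<in> N \<and> J \<in> N \<and>
         (\<exists>u v. I - J = {u} \<and> J - I = {v} \<and> (u, v) \<in> parcs G)} \<rparr>)"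

definition complete_graph :: "nat \<Rightarrow> nat pair_pre_digraph" where
  "complete_graph n = \<lparr> pverts = {..<n}, parcs = {(i, j). i < n \<and> j < n \<and> i \<noteq> j} \<rparr>"

definition path_graph :: "nat \<Rightarrow> nat pair_pre_digraph" where
  "path_graph n =
    \<lparr> pverts = {..<n}, parcs = {(i, j). i < n \<and> j < n \<and> (j = Suc i \<or> i = Suc j)} \<rparr>"

definition disjoint_union ::
    "'a pair_pre_digraph \<Rightarrow> 'b pair_pre_digraph \<Rightarrow> ('a + 'b) pair_pre_digraph" where
  "disjoint_union G H =
    \<lparr> pverts = Inl ` pverts G \<union> Inr ` pverts H,
      parcs = map_prod Inl Inl ` parcs G \<union> map_prod Inr Inr ` parcs H \<rparr>"

definition two_K2 :: "(nat + nat) pair_pre_digraph" where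
  "two_K2 = disjoint_union (complete_graph 2) (complete_graph 2)"

text \<open>
  \<open>D_graph r n s\<close> is \<open>D\<^bsub>r,n,s\<^esub>\<close>, for \<open>r, n, s \<ge> 1\<close>. The path vertices are \<open>Inl 0, \<dots>, Inl (n - 1)\<close>;
  the leaves \<open>Inr k\<close> with \<open>k < r\<close> are attached to \<open>Inl 0\<close> and those with \<open>r \<le> k < r + s\<close> to
  \<open>Inl (n - 1)\<close>.
\<close>

definition D_graph :: "nat \<Rightarrow> nat \<Rightarrow> nat \<Rightarrow> (nat + nat) pair_pre_digraph" where
  "D_graph r n s =
    (let L = {(Inl 0, Inr k) | k. k < r} \<union> {(Inl (n - 1), Inr k) | k. r \<le> k \<and> k < r + s} in
     \<lparr> pverts = Inl ` pverts (path_graph n) \<union> Inr ` {..<r + s},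
       parcs = map_prod Inl Inl ` parcs (path_graph n) \<union> L \<union> L\<inverse> \<rparr>)"

definition has_induced_copy :: "'a pair_pre_digraph \<Rightarrow> 'b pair_pre_digraph \<Rightarrow> bool" where
  "has_induced_copy G F \<longleftrightarrow>
    (\<exists>H. induced_subgraph H (with_proj G) \<and> digraph_iso (with_proj F) H)"

definition family_free :: "'b pair_pre_digraph set \<Rightarrow> 'a pair_pre_digraph \<Rightarrow> bool" where
  "family_free \<F> G \<longleftrightarrow> (\<forall>F\<in>\<F>. \<not> has_induced_copy G F)"

lemma pair_graph_iff:
  "pair_graph G \<longleftrightarrow>
    finite (pverts G) \<and> parcs G \<subseteq> pverts G \<times> pverts G \<and> irrefl (parcs G) \<and> sym (parcs G)"
proof
  assume "pair_graph G"
  then interpret pair_graph G .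
  show "finite (pverts G) \<and> parcs G \<subseteq> pverts G \<times> pverts G \<and> irrefl (parcs G) \<and> sym (parcs G)"
    using pair_finite_verts
    by (auto simp: irrefl_def sym_def dest: in_arcsD1 in_arcsD2 no_loops' arcs_symmetric)
next
  assume *: "finite (pverts G) \<and> parcs G \<subseteq> pverts G \<times> pverts G \<and> irrefl (parcs G) \<and> sym (parcs G)"
  then have "finite (parcs G)"
    by (meson finite_SigmaI finite_subset)
  with * show "pair_graph G"
    by unfold_locales (auto simp: irrefl_def symmetric_def)
qed

lemma pair_graph_TS:
  assumes "pair_graph G"
  shows "pair_graph (TS k G)"
proof -
  have "finite {I. independent_set G I \<and> card I = k}"
    by (rule finite_subset[of _ "Pow (pverts G)"])
      (use assms in \<open>auto simp: pair_graph_iff independent_set_def\<close>)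
  then show ?thesis
    using assms unfolding pair_graph_iff TS_def Let_def irrefl_def sym_def by auto
qed

lemma pair_graph_two_K2: "pair_graph two_K2"
  by (auto simp: pair_graph_iff two_K2_def disjoint_union_def complete_graph_def irrefl_def sym_def)

lemma pair_graph_D_graph:
  assumes "1 \<le> n"
  shows "pair_graph (D_graph r n s)"
  using assms by (auto simp: pair_graph_iff D_graph_def path_graph_def Let_def irrefl_def sym_def)

end

theory Submission
  imports Defs
begin

text \<open>
  Two disjoint nonadjacent edges of \<open>T\<close> give a 4-cycle in \<open>TS\<^sub>2(T)\<close>, and \<open>D\<^bsub>2,2,2\<^esub>\<close> gives an 8-cycle.
  Conversely, an arc of \<open>TS\<^sub>2(T)\<close> slides a token along an edge \<open>uv\<close> while the other token rests on a
  vertex \<open>w\<close> adjacent to neither. An edge at \<open>w\<close> must be joined to \<open>uv\<close>, which yields a path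
  \<open>x a b y\<close>; as \<open>T\<close> is \<open>2K\<^sub>2\<close>-free, every edge then meets \<open>{a, b}\<close>, so \<open>T\<close> is a double star. As \<open>T\<close> is
  \<open>D\<^bsub>2,2,2\<^esub>\<close>-free, one centre, say \<open>b\<close>, carries a single leaf \<open>y\<close>, and \<open>TS\<^sub>2(T)\<close> is a spider with
  centre \<open>{a, y}\<close> and legs \<open>{a, y}, {x, y}, {x, b}\<close>, together with isolated nodes.
\<close>

section \<open>Cycles as arc lists, and the degree condition they force\<close>

lemma pawalk_verts_eq_map_snd: "pcas u p v \<Longrightarrow> pawalk_verts u p = u # map snd p"
  by (induction p arbitrary: u) auto

text \<open>In a walk the vertices after the first are the heads of its arcs, and the base vertex is
  the tail of the first arc. So \<open>cycle\<close> reduces to conditions on the arc list that can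
  be evaluated on explicit lists.\<close>

lemma acyclic_graph_iff:
  assumes "pair_wf_digraph G"
  shows "acyclic_graph G \<longleftrightarrow>
    \<not> (\<exists>u p. set p \<subseteq> parcs G \<and> pcas u p u \<and> distinct (map snd p) \<and> 3 \<le> length p)"
proof -
  interpret pair_wf_digraph G by fact
  have "cycle p \<longleftrightarrow> (\<exists>u. set p \<subseteq> parcs G \<and> pcas u p u \<and> distinct (map snd p))"
    if "3 \<le> length p" for p
  proof -
    have "u \<in> pverts G" if "set p \<subseteq> parcs G" "pcas u p u" for u
      using that \<open>3 \<le> length p\<close> by (cases p) (auto dest: arc_fst_in_verts)
    then show ?thesis
      using that unfolding cycle_def awalk_def
      by (auto simp: pawalk_verts_eq_map_snd)
        (metis list.size(3) not_numeral_le_zero pawalk_verts_eq_map_snd list.sel(3))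
  qed
  then show ?thesis
    unfolding acyclic_graph_def by blast
qed

lemma pcas_nth: "pcas u p v \<Longrightarrow> Suc i < length p \<Longrightarrow> fst (p ! Suc i) = snd (p ! i)"
proof (induction p arbitrary: u i)
  case (Cons e p)
  then show ?case by (cases i; cases p) auto
qed simp

lemma pcas_hd_last: "pcas u p v \<Longrightarrow> p \<noteq> [] \<Longrightarrow> fst (hd p) = u \<and> snd (last p) = v"
  by (induction p arbitrary: u) auto

text \<open>The modulus closes the walk: the last arc ends at the base vertex \<open>u\<close>,
  where the arc of index 0 starts.\<close>

lemma closed_pcas_nth:
  assumes "pcas u p u" "i < length p"
  shows "fst (p ! (Suc i mod length p)) = snd (p ! i)"
proof (cases "Suc i < length p")
  case True
  then show ?thesis using pcas_nth[OF assms(1) True] by simp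
next
  case False
  then have "Suc i = length p" "p \<noteq> []" using assms(2) by auto
  moreover from this have "i = length p - 1" by simp
  ultimately show ?thesis
    using pcas_hd_last[OF assms(1)] by (simp add: hd_conv_nth last_conv_nth)
qed

text \<open>\<open>S\<close> is the vertex set of a cycle, and the two neighbours of
  \<open>v\<close> are its predecessor and successor on that cycle. Acyclicity can then be proved by
  showing, vertex by vertex, that such an \<open>S\<close> is empty.\<close>

lemma cyclic_graph_core:
  assumes "pair_wf_digraph G" "\<not> acyclic_graph G"
  obtains S where "S \<noteq> {}" "S \<subseteq> pverts G"
    "\<And>v. v \<in> S \<Longrightarrow> \<exists>u\<in>S. \<exists>w\<in>S. u \<noteq> w \<and> (u, v) \<in> parcs G \<and> (v, w) \<in> parcs G"
proof -
  interpret pair_wf_digraph G by fact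
  obtain u p where p: "set p \<subseteq> parcs G" "pcas u p u" "distinct (map snd p)" "3 \<le> length p"
    using assms by (auto simp: acyclic_graph_iff)
  let ?n = "length p"
  show thesis
  proof (rule that)
    show "snd ` set p \<noteq> {}" using p(4) by auto
    show "snd ` set p \<subseteq> pverts G" using p(1) arc_snd_in_verts by blast
  next
    fix v assume "v \<in> snd ` set p"
    then obtain i where i: "i < ?n" "v = snd (p ! i)"
      by (auto simp: in_set_conv_nth)
    \<comment> \<open>\<open>j\<close> and \<open>k\<close> are the cyclic predecessor and successor
      of the index \<open>i\<close>: arc \<open>i\<close> runs from the head of arc \<open>j\<close>
      to \<open>v\<close>, and arc \<open>k\<close> leaves \<open>v\<close>.\<close>
    define j where "j = (if i = 0 then ?n - 1 else i - 1)"
    define k where "k = Suc i mod ?n"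
    have j: "j < ?n" "Suc j mod ?n = i" and k: "k < ?n"
      using i p(4) by (auto simp: j_def k_def intro!: mod_less_divisor)
    \<comment> \<open>Here length at least 3 matters: in a closed walk of length 2 both neighbours
      would coincide.\<close>
    have "j \<noteq> k"
      using i p(4) by (cases "Suc i = ?n") (auto simp: j_def k_def)
    then have "snd (p ! j) \<noteq> snd (p ! k)"
      using nth_eq_iff_index_eq[OF p(3)] j k by simp
    moreover have "p ! i = (snd (p ! j), v)"
      using closed_pcas_nth[OF p(2) j(1)] j(2) i(2) by (simp add: prod_eq_iff)
    moreover have "p ! k = (v, snd (p ! k))"
      using closed_pcas_nth[OF p(2) i(1)] i(2) by (simp add: prod_eq_iff k_def)
    moreover have "p ! i \<in> set p" "p ! j \<in> set p" "p ! k \<in> set p"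
      using i(1) j(1) k by auto
    ultimately have "snd (p ! j) \<noteq> snd (p ! k) \<and>
        (snd (p ! j), v) \<in> parcs G \<and> (v, snd (p ! k)) \<in> parcs G"
      using p(1) by auto
    then show "\<exists>u\<in>snd ` set p. \<exists>w\<in>snd ` set p. u \<noteq> w \<and> (u, v) \<in> parcs G \<and> (v, w) \<in> parcs G"
      using j(1) k by (intro bexI[of _ "snd (p ! j)"] bexI[of _ "snd (p ! k)"]) auto
  qed
qed

section \<open>Induced copies of the two forbidden graphs\<close>

text \<open>A subgraph of \<open>with_proj G\<close> has \<open>fst\<close> and \<open>snd\<close>
  as tail and head maps, so the vertex map of the isomorphism already determines its arc map as
  \<open>map_prod f f\<close>.\<close>

lemma has_induced_copy_iff:
  assumes "pair_graph G" "pair_graph F"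
  shows "has_induced_copy G F \<longleftrightarrow>
    (\<exists>f. inj_on f (pverts F) \<and> f ` pverts F \<subseteq> pverts G \<and>
      (\<forall>u\<in>pverts F. \<forall>v\<in>pverts F. (f u, f v) \<in> parcs G \<longleftrightarrow> (u, v) \<in> parcs F))"
proof -
  interpret G: pair_graph G by fact
  interpret F: pair_graph F by fact
  show ?thesis
  proof
    assume "has_induced_copy G F"
    then obtain h where ind: "induced_subgraph (app_iso h (with_proj F)) (with_proj G)"
      and iso: "F.digraph_isomorphism h"
      by (auto simp: has_induced_copy_def digraph_iso_def)
    let ?f = "iso_verts h"
    have inj: "inj_on ?f (pverts F)"
      using F.digraph_isomorphism_inj_on_verts[OF iso] by simp
    have sub: "?f ` pverts F \<subseteq> pverts G"
      using ind by (auto simp: induced_subgraph_def subgraph_def)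
    have tl: "iso_tail h = fst" "iso_head h = snd"
      using ind by (auto simp: induced_subgraph_def subgraph_def compatible_def)
    have arcs: "iso_arcs h ` parcs F = {e \<in> parcs G. fst e \<in> ?f ` pverts F \<and> snd e \<in> ?f ` pverts F}"
      using ind by (auto simp: induced_subgraph_def)
    have e: "iso_arcs h (u, v) = (?f u, ?f v)" if "(u, v) \<in> parcs F" for u v
      using iso that unfolding F.digraph_isomorphism_def by (force simp: tl prod_eq_iff)
    have "(?f u, ?f v) \<in> parcs G \<longleftrightarrow> (u, v) \<in> parcs F" if "u \<in> pverts F" "v \<in> pverts F" for u v
    proof
      assume "(?f u, ?f v) \<in> parcs G"
      then have "(?f u, ?f v) \<in> iso_arcs h ` parcs F"
        using that arcs by auto
      then obtain a b where ab: "(a, b) \<in> parcs F" "(?f u, ?f v) = iso_arcs h (a, b)"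
        by auto
      then have "?f u = ?f a" "?f v = ?f b" using e by auto
      then show "(u, v) \<in> parcs F"
        using ab(1) that inj F.in_arcsD1 F.in_arcsD2 by (metis inj_onD)
    next
      assume "(u, v) \<in> parcs F"
      then show "(?f u, ?f v) \<in> parcs G" using e arcs by force
    qed
    with inj sub show "\<exists>f. inj_on f (pverts F) \<and> f ` pverts F \<subseteq> pverts G \<and>
      (\<forall>u\<in>pverts F. \<forall>v\<in>pverts F. (f u, f v) \<in> parcs G \<longleftrightarrow> (u, v) \<in> parcs F)"
      by blast
  next
    assume "\<exists>f. inj_on f (pverts F) \<and> f ` pverts F \<subseteq> pverts G \<and>
      (\<forall>u\<in>pverts F. \<forall>v\<in>pverts F. (f u, f v) \<in> parcs G \<longleftrightarrow> (u, v) \<in> parcs F)"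
    then obtain f where inj: "inj_on f (pverts F)" and sub: "f ` pverts F \<subseteq> pverts G"
      and arc: "\<And>u v. u \<in> pverts F \<Longrightarrow> v \<in> pverts F \<Longrightarrow> (f u, f v) \<in> parcs G \<longleftrightarrow> (u, v) \<in> parcs F"
      by blast
    define h where "h = \<lparr>iso_verts = f, iso_arcs = map_prod f f, iso_head = snd, iso_tail = fst\<rparr>"
    have sub': "parcs F \<subseteq> pverts F \<times> pverts F"
      using assms(2) by (simp add: pair_graph_iff)
    have "inj_on (map_prod f f) (parcs F)"
      using map_prod_inj_on[OF inj inj] sub' by (rule inj_on_subset)
    then have iso: "F.digraph_isomorphism h"
      using inj F.wf_digraph_axioms by (auto simp: F.digraph_isomorphism_def h_def)
    interpret H: wf_digraph "app_iso h (with_proj F)"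
      using F.wf_digraphI_app_iso[OF iso] .
    have arcs: "map_prod f f ` parcs F = {e \<in> parcs G. fst e \<in> f ` pverts F \<and> snd e \<in> f ` pverts F}"
    proof (intro equalityI subsetI)
      fix e assume "e \<in> map_prod f f ` parcs F"
      then show "e \<in> {e \<in> parcs G. fst e \<in> f ` pverts F \<and> snd e \<in> f ` pverts F}"
        using sub' arc by auto
    next
      fix e assume "e \<in> {e \<in> parcs G. fst e \<in> f ` pverts F \<and> snd e \<in> f ` pverts F}"
      then obtain u v where "e = (f u, f v)" "u \<in> pverts F" "v \<in> pverts F" "e \<in> parcs G"
        by (cases e) auto
      then show "e \<in> map_prod f f ` parcs F"
        using arc by (force simp: image_iff)
    qed
    have "induced_subgraph (app_iso h (with_proj F)) (with_proj G)"
    proof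
      show "subgraph (app_iso h (with_proj F)) (with_proj G)"
        using sub arcs H.wf_digraph_axioms G.wf_digraph_axioms
        by (auto simp: subgraph_def compatible_def h_def)
    qed (use arcs in \<open>auto simp: h_def\<close>)
    then show "has_induced_copy G F"
      using iso unfolding has_induced_copy_def digraph_iso_def by blast
  qed
qed

lemma two_K2_simps:
  "pverts two_K2 = {Inl 0, Inl 1, Inr 0, Inr 1}"
  "parcs two_K2 = {(Inl 0, Inl 1), (Inl 1, Inl 0), (Inr 0, Inr 1), (Inr 1, Inr 0)}"
proof -
  have "{..<2} = {0, 1::nat}" by auto
  moreover have "{(i, j). i < 2 \<and> j < 2 \<and> i \<noteq> j} = {(0, 1), (1, 0::nat)}" by auto
  ultimately show "pverts two_K2 = {Inl 0, Inl 1, Inr 0, Inr 1}"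
    "parcs two_K2 = {(Inl 0, Inl 1), (Inl 1, Inl 0), (Inr 0, Inr 1), (Inr 1, Inr 0)}"
    by (simp_all add: two_K2_def disjoint_union_def complete_graph_def insert_commute)
qed

lemma D_graph_2_2_2_simps:
  "pverts (D_graph 2 2 2) = {Inl 0, Inl 1, Inr 0, Inr 1, Inr 2, Inr 3}"
  "parcs (D_graph 2 2 2) =
    {(Inl 0, Inl 1), (Inl 1, Inl 0), (Inl 0, Inr 0), (Inr 0, Inl 0), (Inl 0, Inr 1), (Inr 1, Inl 0),
     (Inl 1, Inr 2), (Inr 2, Inl 1), (Inl 1, Inr 3), (Inr 3, Inl 1)}"
proof -
  have v: "{..<2} = {0, 1::nat}" "{..<2+2} = {0, 1, 2, 3::nat}" by auto
  have a: "{(i, j). i < 2 \<and> j < 2 \<and> (j = Suc i \<or> i = Suc j)} = {(0, 1), (1, 0::nat)}" by auto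
  have l: "{(Inl 0, Inr k) | k. k < 2} = {(Inl (0::nat), Inr (0::nat)), (Inl 0, Inr 1)}"
    "{(Inl (2 - 1), Inr k) | k. 2 \<le> k \<and> k < 2 + 2} = {(Inl (1::nat), Inr (2::nat)), (Inl 1, Inr 3)}"
    by auto
  show "pverts (D_graph 2 2 2) = {Inl 0, Inl 1, Inr 0, Inr 1, Inr 2, Inr 3}"
    unfolding D_graph_def path_graph_def Let_def pair_pre_digraph.simps v by auto
  show "parcs (D_graph 2 2 2) =
    {(Inl 0, Inl 1), (Inl 1, Inl 0), (Inl 0, Inr 0), (Inr 0, Inl 0), (Inl 0, Inr 1), (Inr 1, Inl 0),
     (Inl 1, Inr 2), (Inr 2, Inl 1), (Inl 1, Inr 3), (Inr 3, Inl 1)}"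
    unfolding D_graph_def path_graph_def Let_def pair_pre_digraph.simps l a by auto
qed

context pair_graph
begin

text \<open>Distinctness follows from the non-arcs: \<open>u = x\<close>, for instance, would turn
  the arc \<open>(x, y)\<close> into the excluded \<open>(u, y)\<close>.\<close>

lemma has_induced_two_K2_iff:
  "has_induced_copy G two_K2 \<longleftrightarrow>
    (\<exists>u v x y. (u, v) \<in> parcs G \<and> (x, y) \<in> parcs G \<and>
      (u, x) \<notin> parcs G \<and> (u, y) \<notin> parcs G \<and> (v, x) \<notin> parcs G \<and> (v, y) \<notin> parcs G)"
proof
  assume "has_induced_copy G two_K2"
  then obtain f where "\<forall>u\<in>pverts two_K2. \<forall>v\<in>pverts two_K2. (f u, f v) \<in> parcs G \<longleftrightarrow> (u, v) \<in> parcs two_K2"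
    using has_induced_copy_iff[OF pair_graph pair_graph_two_K2] by auto
  then show "\<exists>u v x y. (u, v) \<in> parcs G \<and> (x, y) \<in> parcs G \<and>
      (u, x) \<notin> parcs G \<and> (u, y) \<notin> parcs G \<and> (v, x) \<notin> parcs G \<and> (v, y) \<notin> parcs G"
    by (intro exI[of _ "f (Inl 0)"] exI[of _ "f (Inl 1)"] exI[of _ "f (Inr 0)"] exI[of _ "f (Inr 1)"])
      (simp add: two_K2_simps)
next
  assume "\<exists>u v x y. (u, v) \<in> parcs G \<and> (x, y) \<in> parcs G \<and>
      (u, x) \<notin> parcs G \<and> (u, y) \<notin> parcs G \<and> (v, x) \<notin> parcs G \<and> (v, y) \<notin> parcs G"
  then obtain u v x y where *: "(u, v) \<in> parcs G" "(x, y) \<in> parcs G"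
    "(u, x) \<notin> parcs G" "(u, y) \<notin> parcs G" "(v, x) \<notin> parcs G" "(v, y) \<notin> parcs G" by blast
  define f where "f = case_sum (\<lambda>i::nat. if i = 0 then u else v) (\<lambda>i::nat. if i = 0 then x else y)"
  have [simp]: "f (Inl 0) = u" "f (Inl (Suc 0)) = v" "f (Inr 0) = x" "f (Inr (Suc 0)) = y"
    by (simp_all add: f_def)
  have ne: "distinct [u, v, x, y]"
    using * by (auto dest: no_loops' arcs_symmetric)
  have "(x, u) \<notin> parcs G" "(y, u) \<notin> parcs G" "(x, v) \<notin> parcs G" "(y, v) \<notin> parcs G"
    "(v, u) \<in> parcs G" "(y, x) \<in> parcs G"
    using * arcs_symmetric by blast+
  moreover have "(z, z) \<notin> parcs G" for z
    using no_loops' by blast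
  ultimately show "has_induced_copy G two_K2"
    using * ne unfolding has_induced_copy_iff[OF pair_graph pair_graph_two_K2]
    by (intro exI[of _ f]) (auto simp: two_K2_simps dest: in_arcsD1 in_arcsD2)
qed

text \<open>\<open>a\<close> and \<open>b\<close> are the path vertices, \<open>x\<close>,
  \<open>x'\<close> the leaves at \<open>a\<close>, and \<open>y\<close>, \<open>y'\<close> those at
  \<open>b\<close>. Distinctness is recorded explicitly, since two leaves at the same end have
  identical adjacencies.\<close>

lemma has_induced_D_2_2_2E:
  assumes "has_induced_copy G (D_graph 2 2 2)"
  obtains a b x x' y y' where "distinct [a, b, x, x', y, y']"
    "(a, b) \<in> parcs G" "{x, x'} \<subseteq> parcs G `` {a}" "{y, y'} \<subseteq> parcs G `` {b}"
    "parcs G `` {a} \<inter> {y, y'} = {}" "parcs G `` {b} \<inter> {x, x'} = {}"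
    "parcs G \<inter> {x, x', y, y'} \<times> {x, x', y, y'} = {}"
proof -
  obtain f where f: "inj_on f (pverts (D_graph 2 2 2))"
    "\<forall>u\<in>pverts (D_graph 2 2 2). \<forall>v\<in>pverts (D_graph 2 2 2).
      (f u, f v) \<in> parcs G \<longleftrightarrow> (u, v) \<in> parcs (D_graph 2 2 2)"
    using assms has_induced_copy_iff[OF pair_graph pair_graph_D_graph[of 2 2 2]] by auto
  show thesis
    by (rule that[of "f (Inl 0)" "f (Inl 1)" "f (Inr 0)" "f (Inr 1)" "f (Inr 2)" "f (Inr 3)"])
      (use f in \<open>simp_all add: D_graph_2_2_2_simps\<close>)
qed

lemma has_induced_D_2_2_2I:
  assumes "distinct [a, b, x, x', y, y']"
    and "(a, b) \<in> parcs G" "{x, x'} \<subseteq> parcs G `` {a}" "{y, y'} \<subseteq> parcs G `` {b}"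
    and "parcs G `` {a} \<inter> {y, y'} = {}" "parcs G `` {b} \<inter> {x, x'} = {}"
    and "parcs G \<inter> {x, x', y, y'} \<times> {x, x', y, y'} = {}"
  shows "has_induced_copy G (D_graph 2 2 2)"
proof -
  \<comment> \<open>The numbering follows \<open>D_graph\<close>: leaves 0 and 1 hang on
    \<open>Inl 0\<close>, leaves 2 and 3 on \<open>Inl 1\<close>.\<close>
  define f where "f = case_sum (\<lambda>i::nat. if i = 0 then a else b)
    (\<lambda>i::nat. if i = 0 then x else if i = 1 then x' else if i = 2 then y else y')"
  have f: "f (Inl 0) = a" "f (Inl (Suc 0)) = b" "f (Inr 0) = x" "f (Inr (Suc 0)) = x'"
    "f (Inr 2) = y" "f (Inr 3) = y'"
    by (simp_all add: f_def)
  have ir: "(z, z) \<notin> parcs G" for z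
    using no_loops' by blast
  have sy: "(u, v) \<in> parcs G \<longleftrightarrow> (v, u) \<in> parcs G" for u v
    using arcs_symmetric by blast
  have arcs: "(a, b) \<in> parcs G" "(a, x) \<in> parcs G" "(a, x') \<in> parcs G"
      "(b, y) \<in> parcs G" "(b, y') \<in> parcs G"
    and non: "(a, y) \<notin> parcs G" "(a, y') \<notin> parcs G" "(b, x) \<notin> parcs G" "(b, x') \<notin> parcs G"
      "(x, x') \<notin> parcs G" "(x, y) \<notin> parcs G" "(x, y') \<notin> parcs G" "(x', y) \<notin> parcs G"
      "(x', y') \<notin> parcs G" "(y, y') \<notin> parcs G"
    using assms by auto
  have rev: "(b, a) \<in> parcs G" "(x, a) \<in> parcs G" "(x', a) \<in> parcs G"
      "(y, b) \<in> parcs G" "(y', b) \<in> parcs G"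
    and nonrev: "(y, a) \<notin> parcs G" "(y', a) \<notin> parcs G" "(x, b) \<notin> parcs G" "(x', b) \<notin> parcs G"
      "(x', x) \<notin> parcs G" "(y, x) \<notin> parcs G" "(y', x) \<notin> parcs G" "(y, x') \<notin> parcs G"
      "(y', x') \<notin> parcs G" "(y', y) \<notin> parcs G"
    using arcs non sy by blast+
  have "{a, b, x, x', y, y'} \<subseteq> pverts G"
    using arcs by (auto dest: in_arcsD1 in_arcsD2)
  then show "has_induced_copy G (D_graph 2 2 2)"
    using assms(1) arcs non rev nonrev ir
    unfolding has_induced_copy_iff[OF pair_graph pair_graph_D_graph[of 2 2 2, simplified]]
    by (intro exI[of _ f]) (simp add: D_graph_2_2_2_simps f)
qed

section \<open>Nodes and arcs of \<open>TS 2 G\<close>\<close>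

lemma independent_pair_iff:
  "independent_set G {u, v} \<longleftrightarrow> u \<in> pverts G \<and> v \<in> pverts G \<and> (u, v) \<notin> parcs G"
  using no_loops' arcs_symmetric by (auto simp: independent_set_def)

text \<open>The token of \<open>I\<close> other than \<open>u\<close> is the resting one,
  \<open>w\<close>; it lies in \<open>J\<close> because \<open>I - J\<close> contains only
  \<open>u\<close>, and \<open>card J = 2\<close> leaves room just for \<open>v\<close> and
  \<open>w\<close>. The non-arcs express independence.\<close>

lemma TS_2_arc_iff:
  "(I, J) \<in> parcs (TS 2 G) \<longleftrightarrow>
    (\<exists>u v w. I = {u, w} \<and> J = {v, w} \<and> u \<noteq> w \<and> v \<noteq> w \<and> w \<in> pverts G \<and>
      (u, v) \<in> parcs G \<and> (u, w) \<notin> parcs G \<and> (v, w) \<notin> parcs G)"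
proof
  assume "(I, J) \<in> parcs (TS 2 G)"
  then obtain u v where I: "independent_set G I" "card I = 2" and J: "independent_set G J" "card J = 2"
    and uv: "I - J = {u}" "J - I = {v}" "(u, v) \<in> parcs G"
    by (auto simp: TS_def Let_def)
  have u: "u \<in> I" "u \<notin> J" and v: "v \<in> J" "v \<notin> I" using uv by auto
  then have "card (I - {u}) = 1" using I by (simp add: card_Diff_singleton)
  then obtain w where "I - {u} = {w}" by (auto simp: card_1_singleton_iff)
  then have Iw: "I = {u, w}" "u \<noteq> w" using u by auto
  have "w \<notin> I - J" unfolding uv(1) using Iw(2) by simp
  then have "w \<in> J" "v \<noteq> w" using Iw(1) v(2) by auto
  then have "{v, w} \<subseteq> J" "card {v, w} = 2" using v(1) by auto
  moreover have "finite J" using J(2) by (auto intro: card_ge_0_finite)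
  ultimately have "J = {v, w}" using J(2) by (metis card_subset_eq)
  then show "\<exists>u v w. I = {u, w} \<and> J = {v, w} \<and> u \<noteq> w \<and> v \<noteq> w \<and> w \<in> pverts G \<and>
      (u, v) \<in> parcs G \<and> (u, w) \<notin> parcs G \<and> (v, w) \<notin> parcs G"
    using I(1) J(1) Iw \<open>v \<noteq> w\<close> uv(3)
    by (intro exI[of _ u] exI[of _ v] exI[of _ w]) (simp add: independent_pair_iff)
next
  assume "\<exists>u v w. I = {u, w} \<and> J = {v, w} \<and> u \<noteq> w \<and> v \<noteq> w \<and> w \<in> pverts G \<and>
      (u, v) \<in> parcs G \<and> (u, w) \<notin> parcs G \<and> (v, w) \<notin> parcs G"
  then obtain u v w where *: "I = {u, w}" "J = {v, w}" "u \<noteq> w" "v \<noteq> w" "w \<in> pverts G"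
      "(u, v) \<in> parcs G" "(u, w) \<notin> parcs G" "(v, w) \<notin> parcs G" by blast
  have "u \<noteq> v" using *(6) no_loops' by blast
  then have "I - J = {u}" "J - I = {v}"
    unfolding *(1,2) using *(3,4) by auto
  moreover have "independent_set G I" "independent_set G J"
    using * by (auto simp: independent_pair_iff dest: in_arcsD1 in_arcsD2)
  moreover have "card I = 2" "card J = 2" using * by auto
  ultimately show "(I, J) \<in> parcs (TS 2 G)"
    using *(6) by (auto simp: TS_def Let_def)
qed

text \<open>Two forms, so that the moving token may be written first or second in the pair.\<close>

lemma TS_2_arcI:
  assumes "(u, v) \<in> parcs G" "(u, w) \<notin> parcs G" "(v, w) \<notin> parcs G" "u \<noteq> w" "v \<noteq> w" "w \<in> pverts G"
  shows "({u, w}, {v, w}) \<in> parcs (TS 2 G)" "({w, u}, {w, v}) \<in> parcs (TS 2 G)"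
  using assms unfolding TS_2_arc_iff by (auto simp: insert_commute)

lemma pair_wf_digraph_TS: "pair_wf_digraph (TS k G)"
proof -
  interpret TS: pair_graph "TS k G" using pair_graph_TS[OF pair_graph] .
  show ?thesis by unfold_locales
qed

section \<open>Cycles of \<open>TS 2 G\<close> from forbidden subgraphs\<close>

lemma not_acyclic_TS_2_if_two_K2:
  assumes "has_induced_copy G two_K2"
  shows "\<not> acyclic_graph (TS 2 G)"
proof -
  obtain u v x y where *: "(u, v) \<in> parcs G" "(x, y) \<in> parcs G"
    "(u, x) \<notin> parcs G" "(u, y) \<notin> parcs G" "(v, x) \<notin> parcs G" "(v, y) \<notin> parcs G"
    using assms has_induced_two_K2_iff by blast
  have ne: "distinct [u, v, x, y]"
    using * by (auto dest: no_loops' arcs_symmetric)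
  have V: "{u, v, x, y} \<subseteq> pverts G"
    using * by (auto dest: in_arcsD1 in_arcsD2)
  \<comment> \<open>The tokens slide independently along the two edges, taking turns:
    \<open>u\<close> to \<open>v\<close>, \<open>x\<close> to \<open>y\<close>, and then both
    back.\<close>
  let ?p = "[({u, x}, {v, x}), ({v, x}, {v, y}), ({v, y}, {u, y}), ({u, y}, {u, x})]"
  have "set ?p \<subseteq> parcs (TS 2 G)"
    using * ne V arcs_symmetric by (auto intro!: TS_2_arcI)
  moreover have "distinct (map snd ?p)"
    using ne by (auto simp: doubleton_eq_iff)
  moreover have "pcas {u, x} ?p {u, x}" "3 \<le> length ?p" by simp_all
  ultimately show ?thesis
    unfolding acyclic_graph_iff[OF pair_wf_digraph_TS] by blast
qed

lemma not_acyclic_TS_2_if_D_2_2_2: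
  assumes "has_induced_copy G (D_graph 2 2 2)"
  shows "\<not> acyclic_graph (TS 2 G)"
proof -
  obtain a b x x' y y' where ne: "distinct [a, b, x, x', y, y']"
    and *: "(a, b) \<in> parcs G" "{x, x'} \<subseteq> parcs G `` {a}" "{y, y'} \<subseteq> parcs G `` {b}"
      "parcs G `` {a} \<inter> {y, y'} = {}" "parcs G `` {b} \<inter> {x, x'} = {}"
      "parcs G \<inter> {x, x', y, y'} \<times> {x, x', y, y'} = {}"
    using has_induced_D_2_2_2E[OF assms] by metis
  have V: "{a, b, x, x', y, y'} \<subseteq> pverts G"
    using * by (auto dest: in_arcsD1 in_arcsD2)
  \<comment> \<open>One token lives on \<open>a\<close>, \<open>x\<close>, \<open>x'\<close>, the
    other on \<open>b\<close>, \<open>y\<close>, \<open>y'\<close>. While one waits on a leaf, the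
    other crosses its centre to the opposite leaf; the two crossings there and back, in alternation,
    close up after eight slides.\<close>
  let ?p = "[({a, y}, {x, y}), ({x, y}, {x, b}), ({x, b}, {x, y'}), ({x, y'}, {a, y'}),
    ({a, y'}, {x', y'}), ({x', y'}, {x', b}), ({x', b}, {x', y}), ({x', y}, {a, y})]"
  have arcs: "(a, x) \<in> parcs G" "(a, x') \<in> parcs G" "(b, y) \<in> parcs G" "(b, y') \<in> parcs G"
    and non: "(b, x) \<notin> parcs G" "(b, x') \<notin> parcs G" "(a, y) \<notin> parcs G" "(a, y') \<notin> parcs G"
      "(x, y) \<notin> parcs G" "(x, y') \<notin> parcs G" "(x', y) \<notin> parcs G" "(x', y') \<notin> parcs G"
    using * by auto
  note sym_arcs = arcs[THEN arcs_symmetric]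
  have "(y, x) \<notin> parcs G" "(y', x) \<notin> parcs G" "(y, x') \<notin> parcs G" "(y', x') \<notin> parcs G"
    "(x, b) \<notin> parcs G" "(x', b) \<notin> parcs G" "(y, a) \<notin> parcs G" "(y', a) \<notin> parcs G"
    using non arcs_symmetric by metis+
  note all = this arcs non sym_arcs
  have "set ?p \<subseteq> parcs (TS 2 G)"
    using all ne V by (auto intro!: TS_2_arcI)
  moreover have "distinct (map snd ?p)"
    using ne by (auto simp: doubleton_eq_iff)
  moreover have "pcas {a, y} ?p {a, y}" "3 \<le> length ?p" by simp_all
  ultimately show ?thesis
    unfolding acyclic_graph_iff[OF pair_wf_digraph_TS] by blast
qed

section \<open>Double stars with a single leaf at one centre\<close>

text \<open>The hypotheses describe a double star with centres \<open>a\<close> and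
  \<open>b\<close>, where \<open>b\<close> has at most one leaf. A cycle would give a nonempty set
  \<open>S\<close> of nodes each having two neighbours in \<open>S\<close>; every kind of
  independent pair is shown to lie outside it.\<close>

lemma acyclic_TS_2_double_star:
  assumes ab: "(a, b) \<in> parcs G"
    and cover: "\<And>u v. (u, v) \<in> parcs G \<Longrightarrow> {u, v} \<inter> {a, b} \<noteq> {}"
    and disj: "parcs G `` {a} \<inter> parcs G `` {b} = {}"
    and dom: "pverts G \<subseteq> parcs G `` {a} \<union> parcs G `` {b}"
    and single: "\<And>y y'. (b, y) \<in> parcs G \<Longrightarrow> (b, y') \<in> parcs G \<Longrightarrow> y \<noteq> a \<Longrightarrow> y' \<noteq> a \<Longrightarrow> y = y'"
  shows "acyclic_graph (TS 2 G)"
proof (rule ccontr)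
  assume "\<not> acyclic_graph (TS 2 G)"
  from pair_wf_digraph_TS this obtain S where S: "S \<noteq> {}" "S \<subseteq> pverts (TS 2 G)"
    and deg: "\<And>I. I \<in> S \<Longrightarrow> \<exists>J\<in>S. \<exists>K\<in>S. J \<noteq> K \<and> (J, I) \<in> parcs (TS 2 G) \<and> (I, K) \<in> parcs (TS 2 G)"
    by (rule cyclic_graph_core) blast
  interpret TS: pair_graph "TS 2 G" using pair_graph_TS[OF pair_graph] .
  define A where "A = parcs G `` {a} - {b}"
  define B where "B = parcs G `` {b} - {a}"
  have sy: "(u, v) \<in> parcs G \<longleftrightarrow> (v, u) \<in> parcs G" for u v
    using arcs_symmetric by blast
  have Na: "(a, v) \<in> parcs G \<longleftrightarrow> v = b \<or> v \<in> A" for v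
    using ab by (auto simp: A_def)
  have Nb: "(b, v) \<in> parcs G \<longleftrightarrow> v = a \<or> v \<in> B" for v
    using ab sy by (auto simp: B_def)
  have AB: "A \<inter> B = {}" "a \<notin> A" "b \<notin> A" "a \<notin> B" "b \<notin> B" "a \<noteq> b"
    using disj ab no_loops' by (auto simp: A_def B_def)
  \<comment> \<open>Members of \<open>A\<close>, and likewise of \<open>B\<close>, are leaves: by
    \<open>cover\<close> a neighbour is one of the centres, and by \<open>disj\<close> only one
    centre is possible.\<close>
  have NA: "v = a" if "(x, v) \<in> parcs G" "x \<in> A" for x v
    using cover[OF that(1)] that AB sy[of x v] Nb by auto
  have NB: "v = b" if "(y, v) \<in> parcs G" "y \<in> B" for y v
    using cover[OF that(1)] that AB sy[of y v] Na by auto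
  have V: "pverts G \<subseteq> insert a (insert b (A \<union> B))"
    using dom by (auto simp: A_def B_def)
  \<comment> \<open>\<open>K\<close> is free, so a node without any neighbour in \<open>S\<close> is
    covered too, with an arbitrary \<open>K\<close>.\<close>
  have single_nbr: "I \<notin> S" if "\<And>J. J \<in> S \<Longrightarrow> (I, J) \<in> parcs (TS 2 G) \<Longrightarrow> J = K" for I K
    using deg[of I] that TS.arcs_symmetric by metis
  \<comment> \<open>Nodes of degree at most 1 cannot lie in \<open>S\<close>: prune the spider from its leaves \<open>{b, x}\<close> inwards.\<close>
  have bA: "{b, x} \<notin> S" if "x \<in> A" for x
  proof -
    have "\<exists>y\<in>B. J = {x, y}" if "({b, x}, J) \<in> parcs (TS 2 G)" for J
      using that \<open>x \<in> A\<close> NA Na Nb AB sy[of _ a]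
      by (fastforce simp: TS_2_arc_iff doubleton_eq_iff)
    moreover have "y = y'" if "y \<in> B" "y' \<in> B" for y y'
      using single that by (auto simp: B_def)
    ultimately show ?thesis
      using deg[of "{b, x}"] TS.arcs_symmetric by metis
  qed
  \<comment> \<open>Sliding \<open>y\<close> to \<open>b\<close> leads to \<open>{b, x}\<close>,
    already outside \<open>S\<close>; only the slide of \<open>x\<close> to \<open>a\<close>
    remains.\<close>
  have AB_mem: "{x, y} \<notin> S" if "x \<in> A" "y \<in> B" for x y
  proof (rule single_nbr)
    fix J assume "J \<in> S" "({x, y}, J) \<in> parcs (TS 2 G)"
    then show "J = {a, y}"
      using that NA NB bA by (fastforce simp: TS_2_arc_iff doubleton_eq_iff insert_commute)
  qed
  \<comment> \<open>Both tokens could move only to \<open>a\<close>, which is adjacent to the other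
    token. No arc leaves the node, and \<open>{}\<close> is a dummy for \<open>K\<close>; the same
    holds for \<open>BB\<close> with \<open>b\<close>.\<close>
  have AA: "{x, x'} \<notin> S" if "x \<in> A" "x' \<in> A" for x x'
  proof (rule single_nbr)
    fix J assume "({x, x'}, J) \<in> parcs (TS 2 G)"
    then show "J = {}"
      using that NA Na by (fastforce simp: TS_2_arc_iff doubleton_eq_iff)
  qed
  have BB: "{y, y'} \<notin> S" if "y \<in> B" "y' \<in> B" for y y'
  proof (rule single_nbr)
    fix J assume "({y, y'}, J) \<in> parcs (TS 2 G)"
    then show "J = {}"
      using that NB Nb by (fastforce simp: TS_2_arc_iff doubleton_eq_iff)
  qed
  \<comment> \<open>The vertex \<open>b\<close> is adjacent to both tokens, so only slides of
    \<open>a\<close> into \<open>A\<close> are possible, and these end outside \<open>S\<close>.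
    Again \<open>{}\<close> is a dummy.\<close>
  have aB: "{a, y} \<notin> S" if "y \<in> B" for y
  proof (rule single_nbr)
    fix J assume "J \<in> S" "({a, y}, J) \<in> parcs (TS 2 G)"
    then show "J = {}"
      using that NB Na Nb AB_mem sy[of _ b] by (fastforce simp: TS_2_arc_iff doubleton_eq_iff)
  qed
  obtain I where "I \<in> S" using S by blast
  then have "independent_set G I" "card I = 2" using S by (auto simp: TS_def)
  then obtain u v where I: "I = {u, v}" "u \<noteq> v" "u \<in> pverts G" "v \<in> pverts G" "(u, v) \<notin> parcs G"
    by (auto simp: card_2_iff independent_pair_iff)
  \<comment> \<open>The pairs not yet treated, \<open>a\<close> with \<open>b\<close>,
    \<open>a\<close> with \<open>A\<close>, and \<open>b\<close> with \<open>B\<close>, are edges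
    and hence not independent.\<close>
  have "(u = a \<or> u = b \<or> u \<in> A \<or> u \<in> B) \<and> (v = a \<or> v = b \<or> v \<in> A \<or> v \<in> B)"
    using I V by auto
  moreover have "{x, b} \<notin> S" if "x \<in> A" for x
    using bA[OF that] by (simp add: insert_commute)
  moreover have "{y, x} \<notin> S" if "x \<in> A" "y \<in> B" for x y
    using AB_mem[OF that] by (simp add: insert_commute)
  moreover have "{y, a} \<notin> S" if "y \<in> B" for y
    using aB[OF that] by (simp add: insert_commute)
  moreover have "{u, v} \<in> S" "(v, u) \<notin> parcs G"
    using \<open>I \<in> S\<close> I(1,5) sy by auto
  ultimately show False
    using I(2,5) bA AB_mem AA BB aB Na Nb by (elim conjE disjE) simp_all
qed

section \<open>From trees without forbidden subgraphs to double stars\<close>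

lemma acyclic_TS_2_if_tree_free:
  assumes conn: "connected (with_proj G)" and acyc: "acyclic_graph G"
    and no_K: "\<not> has_induced_copy G two_K2" and no_D: "\<not> has_induced_copy G (D_graph 2 2 2)"
  shows "acyclic_graph (TS 2 G)"
proof (rule ccontr)
  assume cyc: "\<not> acyclic_graph (TS 2 G)"
  have wf: "pair_wf_digraph G" by unfold_locales
  have ir: "(z, z) \<notin> parcs G" for z
    using no_loops' by blast
  have sy: "(u, v) \<in> parcs G \<longleftrightarrow> (v, u) \<in> parcs G" for u v
    using arcs_symmetric by blast
  have no_cycle: False if "set p \<subseteq> parcs G" "pcas u p u" "distinct (map snd p)" "3 \<le> length p" for u p
    using acyc that unfolding acyclic_graph_iff[OF wf] by blast
  have no3: False if "(p, q) \<in> parcs G" "(q, r) \<in> parcs G" "(r, p) \<in> parcs G" for p q r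
    using no_cycle[of "[(p, q), (q, r), (r, p)]" p] that ir by auto
  have no4: False if "(p, q) \<in> parcs G" "(q, r) \<in> parcs G" "(r, s) \<in> parcs G" "(s, p) \<in> parcs G"
    "p \<noteq> r" "q \<noteq> s" for p q r s
    using no_cycle[of "[(p, q), (q, r), (r, s), (s, p)]" p] that ir by auto
  have no5: False if "(p, q) \<in> parcs G" "(q, r) \<in> parcs G" "(r, s) \<in> parcs G" "(s, t) \<in> parcs G"
    "(t, p) \<in> parcs G" "distinct [p, q, r, s, t]" for p q r s t
    using no_cycle[of "[(p, q), (q, r), (r, s), (s, t), (t, p)]" p] that by auto
  \<comment> \<open>For edges sharing a vertex the disjunction holds trivially; otherwise it is
    \<open>2K_2\<close>-freeness.\<close>
  have K: "(u, x) \<in> parcs G \<or> (u, y) \<in> parcs G \<or> (v, x) \<in> parcs G \<or> (v, y) \<in> parcs G"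
    if "(u, v) \<in> parcs G" "(x, y) \<in> parcs G" for u v x y
    using no_K that has_induced_two_K2_iff by blast
  \<comment> \<open>Connectedness enters here: the first step of a walk from \<open>w\<close> to
    \<open>u\<close> gives the neighbour.\<close>
  have nbr: "\<exists>z. (w, z) \<in> parcs G" if "w \<in> pverts G" "u \<in> pverts G" "w \<noteq> u" for u w
  proof -
    have "strongly_connected (with_proj G)"
      using symmetric_connected_imp_strongly_connected[OF pair_sym_arcs conn] .
    then have "w \<rightarrow>\<^sup>*\<^bsub>with_proj G\<^esub> u"
      using that by (auto simp: strongly_connected_def)
    then show ?thesis
      using that(3) by (metis converse_reachable_cases)
  qed
  have "\<exists>x a b y. (x, a) \<in> parcs G \<and> (a, b) \<in> parcs G \<and> (b, y) \<in> parcs G \<and>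
    x \<noteq> b \<and> x \<noteq> y \<and> a \<noteq> y"
  proof -
    obtain I J where "(I, J) \<in> parcs (TS 2 G)"
      using cyclic_graph_core[OF pair_wf_digraph_TS cyc] by (metis all_not_in_conv)
    then obtain u v w where *: "u \<noteq> w" "v \<noteq> w" "w \<in> pverts G"
      "(u, v) \<in> parcs G" "(u, w) \<notin> parcs G" "(v, w) \<notin> parcs G"
      unfolding TS_2_arc_iff by blast
    moreover obtain z where "(w, z) \<in> parcs G" using nbr * in_arcsD1 by metis
    \<comment> \<open>As \<open>w\<close> is adjacent to neither \<open>u\<close> nor
      \<open>v\<close>, the joining edge ends at \<open>z\<close>; the path is
      \<open>w z u v\<close> or \<open>w z v u\<close>.\<close>
    ultimately show ?thesis using K[of u v w z] sy by metis
  qed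
  then obtain x a b y where P: "(x, a) \<in> parcs G" "(a, b) \<in> parcs G" "(b, y) \<in> parcs G"
    "x \<noteq> b" "x \<noteq> y" "a \<noteq> y" by blast
  \<comment> \<open>Joining \<open>pq\<close> to the edge \<open>by\<close> closes one of the cycles
    \<open>a b p\<close>, \<open>a b q p\<close>, \<open>a b y p\<close>, \<open>a b y q p\<close>.
    The path is generalized so that its reversal can be used as well.\<close>
  have away: False if P: "(x, a) \<in> parcs G" "(a, b) \<in> parcs G" "(b, y) \<in> parcs G"
    "x \<noteq> b" "x \<noteq> y" "a \<noteq> y" and pq: "(p, q) \<in> parcs G" "{p, q} \<inter> {a, b} = {}" "(a, p) \<in> parcs G"
    for x a b y p q
  proof -
    have "p \<noteq> y" using P pq no3 sy by metis
    moreover have "q \<noteq> y" using P pq no4[of a b y p] sy by blast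
    moreover have "p \<noteq> q" using pq ir by blast
    ultimately have ne: "distinct [a, b, y, q, p]"
      using P pq(2) ir by auto
    from K[OF P(3) pq(1)] show False
    proof (elim disjE)
      assume "(b, p) \<in> parcs G"
      then show False using no3[OF P(2) _ pq(3)[THEN arcs_symmetric]] by blast
    next
      assume "(b, q) \<in> parcs G"
      then show False
        using no4[OF P(2) _ pq(1)[THEN arcs_symmetric] pq(3)[THEN arcs_symmetric]] ne by simp
    next
      assume "(y, p) \<in> parcs G"
      then show False
        using no4[OF P(2,3) _ pq(3)[THEN arcs_symmetric]] ne by simp
    next
      assume "(y, q) \<in> parcs G"
      then show False
        using no5[OF P(2,3) _ pq(1)[THEN arcs_symmetric] pq(3)[THEN arcs_symmetric]] ne by blast
    qed
  qed
  have cover: "{p, q} \<inter> {a, b} \<noteq> {}" if pq: "(p, q) \<in> parcs G" for p q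
  proof
    assume d: "{p, q} \<inter> {a, b} = {}"
    then have d': "{q, p} \<inter> {a, b} = {}" "{p, q} \<inter> {b, a} = {}" "{q, p} \<inter> {b, a} = {}"
      by auto
    \<comment> \<open>By \<open>K\<close>, an end of \<open>pq\<close> is adjacent to
      \<open>a\<close> or \<open>b\<close>. Reversing the path exchanges the centres and reversing
      the arc exchanges \<open>p\<close> and \<open>q\<close>, so \<open>away\<close> settles all
      four cases.\<close>
    note rev = P(3,2,1)[THEN arcs_symmetric] P(6,5,4)[symmetric] and qp = arcs_symmetric[OF pq]
    show False
      using K[OF P(2) pq] away[OF P pq d] away[OF P qp d'(1)] away[OF rev pq d'(2)] away[OF rev qp d'(3)]
      by blast
  qed
  have disj: "parcs G `` {a} \<inter> parcs G `` {b} = {}"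
    using P(2) no3 sy by blast
  have dom: "pverts G \<subseteq> parcs G `` {a} \<union> parcs G `` {b}"
  proof
    fix w assume w: "w \<in> pverts G"
    show "w \<in> parcs G `` {a} \<union> parcs G `` {b}"
    proof (cases "w \<in> {a, b}")
      case True
      then show ?thesis using P(2) sy by auto
    next
      case False
      then obtain z where "(w, z) \<in> parcs G"
        using nbr[OF w in_arcsD1[OF P(2)]] by auto
      then show ?thesis using cover False sy by blast
    qed
  qed
  have cover': "{p, q} \<inter> {b, a} \<noteq> {}" if "(p, q) \<in> parcs G" for p q
    using cover[OF that] by auto
  have disj': "parcs G `` {b} \<inter> parcs G `` {a} = {}" and dom': "pverts G \<subseteq> parcs G `` {b} \<union> parcs G `` {a}"
    using disj dom by auto
  \<comment> \<open>Since \<open>TS 2 G\<close> has a cycle, the double-star lemma fails for both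
    orders of the centres. Each centre thus has two leaves, and these form the forbidden
    \<open>D_graph 2 2 2\<close>.\<close>
  have "\<exists>y y'. (b, y) \<in> parcs G \<and> (b, y') \<in> parcs G \<and> y \<noteq> a \<and> y' \<noteq> a \<and> y \<noteq> y'"
    using acyclic_TS_2_double_star[OF P(2) cover disj dom] cyc by blast
  moreover have "\<exists>x x'. (a, x) \<in> parcs G \<and> (a, x') \<in> parcs G \<and> x \<noteq> b \<and> x' \<noteq> b \<and> x \<noteq> x'"
    using acyclic_TS_2_double_star[OF P(2)[THEN arcs_symmetric] cover' disj' dom'] cyc by blast
  ultimately obtain x x' y y' where D: "(b, y) \<in> parcs G" "(b, y') \<in> parcs G" "y \<noteq> a" "y' \<noteq> a" "y \<noteq> y'"
    "(a, x) \<in> parcs G" "(a, x') \<in> parcs G" "x \<noteq> b" "x' \<noteq> b" "x \<noteq> x'" by blast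
  have "parcs G \<inter> {x, x', y, y'} \<times> {x, x', y, y'} = {}"
    using cover D ir by blast
  moreover have "distinct [a, b, x, x', y, y']"
    using D P(2) disj ir by auto
  moreover have "{x, x'} \<subseteq> parcs G `` {a}" "{y, y'} \<subseteq> parcs G `` {b}"
    "parcs G `` {a} \<inter> {y, y'} = {}" "parcs G `` {b} \<inter> {x, x'} = {}"
    using D disj by blast+
  ultimately have "has_induced_copy G (D_graph 2 2 2)"
    using has_induced_D_2_2_2I P(2) by metis
  then show False using no_D by contradiction
qed

end

theorem proposition2:
  fixes T :: "'a pair_pre_digraph"
  assumes "tree_graph T"
  shows "acyclic_graph (TS 2 T) \<longleftrightarrow> family_free {two_K2, D_graph 2 2 2} T"
proof -
  interpret pair_graph T using assms by (simp add: tree_graph_def)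
  show ?thesis
    using assms not_acyclic_TS_2_if_two_K2 not_acyclic_TS_2_if_D_2_2_2 acyclic_TS_2_if_tree_free
    by (auto simp: tree_graph_def family_free_def)
qed

end
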